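(* Let $p\ge2$. Then there is a constant $a_p>0$ such that the number of $BCI(p)$-terms of size $(2p+1)n-1$ is asymptotically, as $n\to\infty$, $$A_p\,\beta_p^{\,n-1}\,n^{\gamma_p}\,(n-1)!^p,$$ where $A_p=a_pB_p$, $$B_p=C_{p-1}\prod_{k=1}^p\frac{1}{\Gamma\!\left(1+\frac{2(p-k)-1}{2p+1}\right)},\qquad C_{p-1}=\frac1p\binom{2p-2}{p-1},\qquad \beta_p=\frac{(4p+2)^p}{p!},\qquad \gamma_p=\frac{p(p-2)}{2p+1},$$ and $a_p=1+O\!\left(\frac{1}{pe^p}\right)$ as $p\to\infty$.
   Context: Lambda-terms are generated by the grammar $T::=x\mid (T*T)\mid \lambda x.T$; an abstraction $\lambda x.T$ binds the free occurrences of $x$ in $T$; a term is closed if no variable occurrence is free. Terms are counted up to renaming of bound variables (only the binding structure matters). Equivalently a closed lambda-term is a rooted plane unary-binary tree (applications = binary nodes with ordered children, abstractions = unary nodes, variable occurrences = leaves) with, for each leaf, a pointer from exactly one unary ancestor. Size: $|x|=1$, $|\lambda x.T|=1+|T|$, $|(S*T)|=1+|S|+|T|$. $BCI(p)$ is the set of (non-empty) closed lambda-terms in which every abstraction binds exactly $p$ variable occurrences. *)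

theory Defs
  imports "HOL-Analysis.Analysis" "HOL-Library.Landau_Symbols"
begin

text \<open>
  Lambda-terms up to renaming of bound variables, in de Bruijn form: a leaf \<open>Var i\<close> below at
  least \<open>i + 1\<close> abstractions points to the \<open>i\<close>-th abstraction (counted from 0) on the way up to the
  root; an index that exceeds the number of enclosing abstractions is a free variable.
\<close>

datatype lterm = Var nat | App lterm lterm | Lam lterm

text \<open>Not the function \<open>size\<close> generated by the datatype package, which gives leaves size 0.\<close>

primrec term_size :: "lterm \<Rightarrow> nat" where
  "term_size (Var i) = 1"
| "term_size (App s t) = 1 + term_size s + term_size t"
| "term_size (Lam t) = 1 + term_size t"

text \<open>
  \<open>free_occs k t\<close> is the number of free occurrences in \<open>t\<close> of the variable that has index \<open>k\<close> at the
  root of \<open>t\<close>. In particular, \<open>Lam t\<close> binds exactly \<open>free_occs 0 t\<close> occurrences.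
\<close>

primrec free_occs :: "nat \<Rightarrow> lterm \<Rightarrow> nat" where
  "free_occs k (Var i) = (if i = k then 1 else 0)"
| "free_occs k (App s t) = free_occs k s + free_occs k t"
| "free_occs k (Lam t) = free_occs (Suc k) t"

definition closed_term :: "lterm \<Rightarrow> bool" where
  "closed_term t \<longleftrightarrow> (\<forall>k. free_occs k t = 0)"

primrec abs_bind :: "nat \<Rightarrow> lterm \<Rightarrow> bool" where
  "abs_bind p (Var i) \<longleftrightarrow> True"
| "abs_bind p (App s t) \<longleftrightarrow> abs_bind p s \<and> abs_bind p t"
| "abs_bind p (Lam t) \<longleftrightarrow> free_occs 0 t = p \<and> abs_bind p t"

definition BCI :: "nat \<Rightarrow> lterm set" where
  "BCI p = {t. closed_term t \<and> abs_bind p t}"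

definition BCI_count :: "nat \<Rightarrow> nat \<Rightarrow> nat" where
  "BCI_count p m = card {t \<in> BCI p. term_size t = m}"

text \<open>The set counted above is finite, so its \<open>card\<close> is the genuine number of terms.\<close>

lemma finite_terms_of_size: "finite {t. term_size t = m \<and> (\<forall>k\<ge>d. free_occs k t = 0)}"
proof (induction m arbitrary: d rule: less_induct)
  case (less m)
  define S where "S m d = {t. term_size t = m \<and> (\<forall>k\<ge>d. free_occs k t = 0)}" for m d
  have "t \<in> Var ` {..<d} \<union> Lam ` (\<Union>i<m. S i (Suc d))
          \<union> (\<lambda>(s, t). App s t) ` ((\<Union>i<m. S i d) \<times> (\<Union>i<m. S i d))"
    if "t \<in> S m d" for t
  proof (cases t)
    case (Var i)
    then show ?thesis using that by (force simp: S_def not_le[symmetric])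
  next
    case (App s u)
    then show ?thesis using that by (auto simp: S_def image_iff)
  next
    case (Lam u)
    then have "\<forall>k\<ge>Suc d. free_occs k u = 0"
      using that by (simp add: S_def) (metis Suc_le_D Suc_le_mono)
    then show ?thesis using that Lam by (auto simp: S_def)
  qed
  then have "S m d \<subseteq> Var ` {..<d} \<union> Lam ` (\<Union>i<m. S i (Suc d))
          \<union> (\<lambda>(s, t). App s t) ` ((\<Union>i<m. S i d) \<times> (\<Union>i<m. S i d))"
    by blast
  moreover have "finite (S i e)" if "i < m" for i e
    using less.IH[OF that] by (simp add: S_def)
  ultimately have "finite (S m d)"
    by (elim finite_subset) auto
  then show ?case by (simp add: S_def)
qed

lemma finite_BCI: "finite {t \<in> BCI p. term_size t = m}"
  by (rule finite_subset[OF _ finite_terms_of_size[of m 0]]) (auto simp: BCI_def closed_term_def)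

definition B_const :: "nat \<Rightarrow> real" where
  "B_const p = (1 / real p) * real ((2 * p - 2) choose (p - 1)) *
     (\<Prod>k=1..p. 1 / Gamma (1 + (2 * (real p - real k) - 1) / (2 * real p + 1)))"

definition beta_const :: "nat \<Rightarrow> real" where
  "beta_const p = (4 * real p + 2) ^ p / fact p"

definition gamma_const :: "nat \<Rightarrow> real" where
  "gamma_const p = real p * (real p - 2) / (2 * real p + 1)"

end

theory Submission
  imports Defs "HOL-Library.Multiset"
begin

text \<open>
  Let \<open>b n\<close> be the number of \<open>BCI p\<close>-terms with \<open>n\<close> abstractions, that is, of size \<open>(2p+1)n - 1\<close>.
  As in Remy's algorithm for binary trees, a new labelled leaf can be grafted onto a term of size
  \<open>m\<close> in \<open>2m\<close> ways (a node and a side), and this adds 2 to the size. Grafting \<open>p\<close> leaves on a closed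
  term and binding them by a new abstraction gives
  \<open>b (n+1) = c n * b n + (\<Sum>i=1..n. b i * b (n+1-i))\<close> with
  \<open>c n = 2^p/p! * (\<Prod>k<p. (2p+1)n - 1 + 2k)\<close>, and \<open>b 1\<close> is a Catalan number. Let
  \<open>P n = b 1 * (\<Prod>j=1..<n. c j)\<close>, whose asymptotics follow from the limit formula for \<open>Gamma\<close>. The ratio
  \<open>b n / P n\<close> increases from 1, and since \<open>c n \<ge> c 1 * n^2\<close>, the quadratic terms raise it by at most
  \<open>24 * b 1 / c 1 \<le> 24 / (p 4^p)\<close> in total; its limit is \<open>a p\<close>.
\<close>

section \<open>Grafting and deleting a labelled leaf\<close>

primrec insert_leaf :: "nat \<Rightarrow> lterm \<Rightarrow> lterm multiset" where
  "insert_leaf k (Var i) = {#App (Var k) (Var i), App (Var i) (Var k)#}"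
| "insert_leaf k (App s t) = {#App (Var k) (App s t), App (App s t) (Var k)#}
     + image_mset (\<lambda>x. App x t) (insert_leaf k s) + image_mset (App s) (insert_leaf k t)"
| "insert_leaf k (Lam t) = {#App (Var k) (Lam t), App (Lam t) (Var k)#}
     + image_mset Lam (insert_leaf (Suc k) t)"

text \<open>The reverse of grafting. Both operations return multisets because distinct positions may
  give the same term: \<open>App (Var k) (Var k)\<close> arises from \<open>Var k\<close> by two
  grafts and returns to it by two deletions.\<close>

primrec delete_leaf :: "nat \<Rightarrow> lterm \<Rightarrow> lterm multiset" where
  "delete_leaf k (Var i) = {#}"
| "delete_leaf k (App s t) = (if s = Var k then {#t#} else {#}) + (if t = Var k then {#s#} else {#})
     + image_mset (\<lambda>x. App x t) (delete_leaf k s) + image_mset (App s) (delete_leaf k t)"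
| "delete_leaf k (Lam t) = image_mset Lam (delete_leaf (Suc k) t)"

lemma count_image_mset_App_left:
  "count (image_mset (\<lambda>x. App x t) M) u = (case u of App a b \<Rightarrow> of_bool (b = t) * count M a | _ \<Rightarrow> 0)"
  by (induction M) (simp_all split: lterm.split)

lemma count_image_mset_App_right:
  "count (image_mset (App s) M) u = (case u of App a b \<Rightarrow> of_bool (a = s) * count M b | _ \<Rightarrow> 0)"
  by (induction M) (simp_all split: lterm.split)

lemma count_image_mset_Lam:
  "count (image_mset Lam M) u = (case u of Lam a \<Rightarrow> count M a | _ \<Rightarrow> 0)"
  by (induction M) (simp_all split: lterm.split)

text \<open>Keeps the equality test as an \<open>of_bool\<close> summand instead of an
  \<open>if\<close>, so that both sides of the symmetry below expand to comparable sums.\<close>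

lemma count_add_mset_of_bool: "count (add_mset x M) u = of_bool (u = x) + count M u"
  by simp

lemma count_singleton_if: "count (if P then {#x#} else {#}) u = of_bool (P \<and> u = x)"
  by simp

lemmas count_leaf_moves = count_add_mset_of_bool count_singleton_if
  count_image_mset_App_left count_image_mset_App_right count_image_mset_Lam

text \<open>The basis of the double counting: grafts that lead from \<open>s\<close> to
  \<open>t\<close> correspond to deletions that lead back, multiplicities included.\<close>

lemma count_insert_leaf_eq_count_delete_leaf: "count (insert_leaf k s) t = count (delete_leaf k t) s"
proof (induction t arbitrary: s k)
  case (Var i)
  show ?case by (cases s) (simp_all add: count_leaf_moves del: count_add_mset)
next
  case (App a b)
  show ?case
    by (cases s) (simp_all add: count_leaf_moves App.IH conj_commute eq_commute
        del: count_add_mset split del: if_split)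
next
  case (Lam a)
  show ?case by (cases s) (simp_all add: count_leaf_moves Lam.IH del: count_add_mset)
qed

lemma in_insert_leaf_iff: "t \<in># insert_leaf k s \<longleftrightarrow> s \<in># delete_leaf k t"
  by (simp add: count_insert_leaf_eq_count_delete_leaf flip: count_greater_zero_iff)

lemma size_insert_leaf: "size (insert_leaf k t) = 2 * term_size t"
  by (induction t arbitrary: k) auto

lemma term_size_insert_leaf: "t \<in># insert_leaf k s \<Longrightarrow> term_size t = term_size s + 2"
  by (induction s arbitrary: k t) auto

lemma free_occs_insert_leaf:
  "t \<in># insert_leaf k s \<Longrightarrow> free_occs i t = free_occs i s + (if i = k then 1 else 0)"
  by (induction s arbitrary: k t i) auto

lemma abs_bind_insert_leaf: "t \<in># insert_leaf k s \<Longrightarrow> abs_bind p t = abs_bind p s"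
  by (induction s arbitrary: k t) (auto simp: free_occs_insert_leaf)

text \<open>The leaf in \<open>Lam (Var (Suc k))\<close> could not be deleted, but this abstraction binds nothing.\<close>

lemma size_delete_leaf:
  assumes "abs_bind p t" "p > 0" "t \<noteq> Var k"
  shows "size (delete_leaf k t) = free_occs k t"
  using assms
proof (induction t arbitrary: k)
  case (App s t)
  then show ?case by (cases "s = Var k"; cases "t = Var k") auto
next
  case (Lam t)
  then have "t \<noteq> Var (Suc k)" by auto
  with Lam show ?case by simp
qed auto

section \<open>Terms with a single free variable\<close>

lemma term_size_neq_0 [simp]: "term_size t \<noteq> 0"
  by (cases t) auto

text \<open>A term with l leaves has l - 1 applications, hence size at least 2l - 1.\<close>

lemma free_occs_le_term_size: "2 * free_occs k t \<le> Suc (term_size t)"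
proof (induction t arbitrary: k)
  case (App s t)
  from App(1)[of k] App(2)[of k] show ?case by simp
next
  case (Lam t)
  from Lam[of "Suc k"] show ?case by simp
qed simp

text \<open>The intermediate stages of grafting: \<open>j = 0\<close> gives the closed terms,
  \<open>j = p\<close> the possible bodies of an abstraction at the root.\<close>

definition hole_terms :: "nat \<Rightarrow> nat \<Rightarrow> nat \<Rightarrow> lterm set" where
  "hole_terms p j m = {t. term_size t = m \<and> abs_bind p t \<and> (\<forall>k. free_occs k t = (if k = 0 then j else 0))}"

lemma finite_hole_terms: "finite (hole_terms p j m)"
  by (rule finite_subset[OF _ finite_terms_of_size[of m 1]]) (auto simp: hole_terms_def)

lemma BCI_count_eq: "BCI_count p m = card (hole_terms p 0 m)"
  unfolding BCI_count_def BCI_def hole_terms_def closed_term_def by (rule arg_cong[of _ _ card]) auto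

lemma size_eq_sum_count: "finite A \<Longrightarrow> set_mset M \<subseteq> A \<Longrightarrow> size M = (\<Sum>x\<in>A. count M x)"
  unfolding size_multiset_overloaded_eq by (rule sum.mono_neutral_left) (auto simp: not_in_iff)

text \<open>Double counting of grafts: each smaller term admits \<open>2 * m\<close> of them, and
  each larger term is undone in \<open>Suc j\<close> ways.\<close>

lemma card_hole_terms_Suc:
  assumes "p > 0"
  shows "Suc j * card (hole_terms p (Suc j) (m + 2)) = 2 * m * card (hole_terms p j m)"
proof -
  let ?A = "hole_terms p j m" and ?B = "hole_terms p (Suc j) (m + 2)"
  \<comment> \<open>Hence neither inner sum below misses a graft or a deletion.\<close>
  have AB: "s \<in> ?A \<longleftrightarrow> t \<in> ?B" if "t \<in># insert_leaf 0 s" for s t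
    using term_size_insert_leaf[OF that] free_occs_insert_leaf[OF that] abs_bind_insert_leaf[OF that]
    by (auto simp: hole_terms_def)
  have "2 * m = (\<Sum>t\<in>?B. count (insert_leaf 0 s) t)" if "s \<in> ?A" for s
  proof -
    have "size (insert_leaf 0 s) = 2 * m"
      using that by (simp add: size_insert_leaf hole_terms_def)
    then show ?thesis
      using AB that by (subst size_eq_sum_count[symmetric]) (auto simp: finite_hole_terms)
  qed
  then have "(\<Sum>s\<in>?A. 2 * m) = (\<Sum>s\<in>?A. \<Sum>t\<in>?B. count (insert_leaf 0 s) t)"
    by (rule sum.cong[OF refl])
  then have "2 * m * card ?A = (\<Sum>s\<in>?A. \<Sum>t\<in>?B. count (insert_leaf 0 s) t)"
    by (simp only: sum_constant of_nat_id mult.commute)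
  also have "\<dots> = (\<Sum>t\<in>?B. \<Sum>s\<in>?A. count (delete_leaf 0 t) s)"
    by (subst sum.swap) (simp add: count_insert_leaf_eq_count_delete_leaf)
  also have "\<dots> = (\<Sum>t\<in>?B. Suc j)"
  proof (rule sum.cong[OF refl])
    fix t assume t: "t \<in> ?B"
    \<comment> \<open>\<open>t\<close> has size \<open>m + 2\<close>, so it is not the bare leaf
      \<open>Var 0\<close> excluded in \<open>size_delete_leaf\<close>.\<close>
    then have "size (delete_leaf 0 t) = Suc j"
      using assms by (subst size_delete_leaf) (auto simp: hole_terms_def)
    then show "(\<Sum>s\<in>?A. count (delete_leaf 0 t) s) = Suc j"
      using AB t in_insert_leaf_iff
      by (subst size_eq_sum_count[symmetric]) (auto simp: finite_hole_terms)
  qed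
  finally show ?thesis by simp
qed

text \<open>Iterated grafting: graft number \<open>i\<close>, counted from 0, acts on a term of size
  \<open>m + 2 * i\<close>, and \<open>fact j\<close> forgets the order of the grafts.\<close>

lemma card_hole_terms_add:
  assumes "p > 0"
  shows "real (card (hole_terms p j (m + 2 * j))) =
           2 ^ j / fact j * (\<Prod>i<j. real m + 2 * real i) * real (card (hole_terms p 0 m))"
proof (induction j)
  case (Suc j)
  have "real (Suc j) * real (card (hole_terms p (Suc j) (m + 2 * j + 2))) =
          2 * (real m + 2 * real j) * real (card (hole_terms p j (m + 2 * j)))"
    using arg_cong[OF card_hole_terms_Suc[OF assms, of j "m + 2 * j"], of real]
    by (simp add: algebra_simps)
  then have "real (card (hole_terms p (Suc j) (m + 2 * j + 2))) =
          2 * (real m + 2 * real j) / real (Suc j) * real (card (hole_terms p j (m + 2 * j)))"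
    by (simp add: field_simps del: of_nat_Suc)
  with Suc.IH show ?case by (simp del: of_nat_Suc)
qed simp

lemma hole_terms_eq_empty: "Suc m < 2 * j \<Longrightarrow> hole_terms p j m = {}"
proof (rule equals0I)
  fix t assume "Suc m < 2 * j" "t \<in> hole_terms p j m"
  then show False using free_occs_le_term_size[of 0 t] by (simp add: hole_terms_def)
qed

lemma hole_terms_1_1: "hole_terms p 1 1 = {Var 0}"
proof -
  have "t = Var 0" if "t \<in> hole_terms p 1 1" for t
    using that by (cases t) (auto simp: hole_terms_def split: if_splits)
  then show ?thesis by (auto simp: hole_terms_def)
qed

lemma central_binomial_Suc:
  "Suc j * (2 * Suc j choose Suc j) = 2 * (2 * j + 1) * (2 * j choose j)"
proof -
  have "2 * Suc j choose Suc j = (2 * j + 1 choose j) + (2 * j + 1 choose Suc j)"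
    by simp
  also have "2 * j + 1 choose j = 2 * j + 1 choose Suc j"
    by (subst binomial_symmetric) auto
  finally have "Suc j * (2 * Suc j choose Suc j) = 2 * (Suc j * (Suc (2 * j) choose Suc j))"
    by simp
  also have "Suc j * (Suc (2 * j) choose Suc j) = (2 * j + 1) * (2 * j choose j)"
    using Suc_times_binomial_eq[of "2 * j" j] by (metis mult.commute Suc_eq_plus1)
  finally show ?thesis by simp
qed

text \<open>At this size there is no room for abstractions: the terms are binary trees with
  \<open>j\<close> applications and all leaves equal. Grafting from \<open>Var 0\<close> is then
  Remy's recurrence for the Catalan numbers.\<close>

lemma card_hole_terms_Catalan:
  assumes "p > 0"
  shows "Suc j * card (hole_terms p (Suc j) (2 * j + 1)) = (2 * j choose j)"
proof (induction j)
  case 0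
  then show ?case using hole_terms_1_1 by simp
next
  case (Suc j)
  have "Suc j * (Suc (Suc j) * card (hole_terms p (Suc (Suc j)) (2 * j + 1 + 2))) =
      2 * (2 * j + 1) * (Suc j * card (hole_terms p (Suc j) (2 * j + 1)))"
    by (subst card_hole_terms_Suc[OF assms]) (simp only: mult_ac)
  also have "\<dots> = Suc j * (2 * Suc j choose Suc j)"
    by (simp only: Suc.IH central_binomial_Suc)
  finally show ?case
    by (simp only: mult_cancel1) simp
qed

section \<open>Decomposition at the root and the recurrence\<close>

lemma card_hole_terms_0_Suc:
  "card (hole_terms p 0 (Suc m)) =
     (\<Sum>a\<le>m. card (hole_terms p 0 a) * card (hole_terms p 0 (m - a))) + card (hole_terms p p m)"
proof -
  \<comment> \<open>The size \<open>a\<close> of the left subterm is carried along to index the sum;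
    \<open>s\<close> determines it, so \<open>?f\<close> is injective on \<open>?S\<close>.\<close>
  let ?S = "Sigma {..m} (\<lambda>a. hole_terms p 0 a \<times> hole_terms p 0 (m - a))"
  let ?f = "\<lambda>(a::nat, s, t). App s t"
  have "hole_terms p 0 (Suc m) = ?f ` ?S \<union> Lam ` hole_terms p p m" (is "?L = ?R")
  proof
    show "?L \<subseteq> ?R"
    proof
      fix t assume t: "t \<in> ?L"
      show "t \<in> ?R"
      proof (cases t)
        case (Var i)
        with t have "free_occs i (Var i) = 0" by (simp only: hole_terms_def mem_Collect_eq if_cancel)
        then show ?thesis by simp
      next
        case (App s u)
        with t have "(term_size s, s, u) \<in> ?S" by (auto simp: hole_terms_def)
        then have "?f (term_size s, s, u) \<in> ?f ` ?S" by (rule imageI)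
        with App show ?thesis by simp
      next
        case (Lam u)
        have "free_occs k u = (if k = 0 then p else 0)" for k
          using t Lam by (cases k) (auto simp: hole_terms_def)
        with t Lam have "u \<in> hole_terms p p m" by (auto simp: hole_terms_def)
        with Lam show ?thesis by blast
      qed
    qed
    show "?R \<subseteq> ?L" by (auto simp: hole_terms_def)
  qed
  moreover have "card (?f ` ?S) = (\<Sum>a\<le>m. card (hole_terms p 0 a) * card (hole_terms p 0 (m - a)))"
  proof -
    have "inj_on ?f ?S" by (auto simp: inj_on_def hole_terms_def)
    then have "card (?f ` ?S) = card ?S" by (rule card_image)
    then show ?thesis by (simp add: card_cartesian_product card_SigmaI finite_hole_terms)
  qed
  moreover have "card (Lam ` hole_terms p p m) = card (hole_terms p p m)"
    by (rule card_image) (auto simp: inj_on_def)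
  moreover have "?f ` ?S \<inter> Lam ` hole_terms p p m = {}" by auto
  ultimately show ?thesis
    by (simp add: card_Un_disjoint finite_hole_terms)
qed

lemma hole_terms_0_0: "hole_terms p j 0 = {}"
  by (auto simp: hole_terms_def)

text \<open>With n abstractions there are pn leaves and pn - 1 applications, so the size plus 1 is
  (2p+1)n. In the induction, an application adds the values of size plus 1 of its two parts, and an
  abstraction over \<open>p\<close> grafted leaves raises this value by
  \<open>2 * p + 1\<close>.\<close>

lemma dvd_of_hole_terms_0:
  assumes "p > 0" "card (hole_terms p 0 m) \<noteq> 0"
  shows "2 * p + 1 dvd Suc m"
  using assms(2)
proof (induction m rule: less_induct)
  case (less m)
  obtain q where q: "m = Suc q"
    using less.prems by (cases m) (auto simp: hole_terms_0_0)
  consider a where "a \<le> q" "card (hole_terms p 0 a) \<noteq> 0" "card (hole_terms p 0 (q - a)) \<noteq> 0"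
    | "card (hole_terms p p q) \<noteq> 0"
    using less.prems unfolding q card_hole_terms_0_Suc by (auto simp: finite_hole_terms)
  then show ?case
  proof cases
    case 1
    then have "2 * p + 1 dvd Suc a + Suc (q - a)"
      by (intro dvd_add less.IH) (auto simp: q)
    with 1 q show ?thesis by simp
  next
    case 2
    show ?thesis
    proof (cases "2 * p \<le> q")
      case True
      define r where "r = q - 2 * p"
      have r: "q = r + 2 * p" using True by (simp add: r_def)
      have "card (hole_terms p 0 r) \<noteq> 0"
        using 2 card_hole_terms_add[OF assms(1), of p r] unfolding r
        by (metis mult_zero_right of_nat_0 of_nat_eq_0_iff)
      then have "2 * p + 1 dvd Suc r + (2 * p + 1)"
        by (intro dvd_add[OF less.IH dvd_refl]) (auto simp: q r)
      moreover have "Suc m = Suc r + (2 * p + 1)" by (simp add: q r)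
      ultimately show ?thesis by (simp only:)
    next
      case False
      have "\<not> Suc q < 2 * p" using hole_terms_eq_empty[of q p p] 2 by auto
      \<comment> \<open>The body is too small to come from grafting on a closed term, so
        \<open>q = 2 * p - 1\<close>: one abstraction over a binary tree.\<close>
      with False have "Suc m = 2 * p + 1" using q by simp
      then show ?thesis by simp
    qed
  qed
qed

text \<open>The coefficient \<open>c n\<close> of the recurrence: \<open>card_hole_terms_add\<close>
  with \<open>j = p\<close> and \<open>m = (2p+1)n - 1\<close>.\<close>

definition lam_factor :: "nat \<Rightarrow> nat \<Rightarrow> real" where
  "lam_factor p n = 2 ^ p / fact p * (\<Prod>i<p. (2 * real p + 1) * real n - 1 + 2 * real i)"

abbreviation bci :: "nat \<Rightarrow> nat \<Rightarrow> real" where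
  "bci p n \<equiv> real (BCI_count p ((2 * p + 1) * n - 1))"

text \<open>By divisibility no closed term is smaller than \<open>2 * p\<close>, so the root is an
  abstraction and its body is counted by a Catalan number.\<close>

lemma bci_1:
  assumes "p > 0"
  shows "bci p 1 = (1 / real p) * real ((2 * p - 2) choose (p - 1))"
proof -
  obtain q where q: "p = Suc q" using assms by (cases p) auto
  have "card (hole_terms p 0 (Suc (2 * q + 1))) = card (hole_terms p p (2 * q + 1))"
  proof -
    have "card (hole_terms p 0 a) = 0" if "a \<le> 2 * q + 1" for a
    proof (rule ccontr)
      assume "card (hole_terms p 0 a) \<noteq> 0"
      then have "2 * p + 1 \<le> Suc a" using dvd_of_hole_terms_0[OF assms] by (intro dvd_imp_le) auto
      with that q show False by simp
    qed
    then show ?thesis by (simp add: card_hole_terms_0_Suc)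
  qed
  moreover have "real (Suc q) * real (card (hole_terms p p (2 * q + 1))) = real (2 * q choose q)"
    using card_hole_terms_Catalan[OF assms, of q] unfolding q by (metis of_nat_mult)
  moreover have "(2 * p + 1) * 1 - 1 = Suc (2 * q + 1)" using q by simp
  ultimately have "real p * bci p 1 = real (2 * q choose q)"
    by (simp only: BCI_count_eq q)
  then show ?thesis using assms by (simp add: q field_simps del: of_nat_Suc)
qed

lemma bci_Suc:
  assumes "p > 0" "n > 0"
  shows "bci p (Suc n) = lam_factor p n * bci p n + (\<Sum>i=1..n. bci p i * bci p (Suc n - i))"
proof -
  define N where "N m = card (hole_terms p 0 m)" for m
  define P where "P = 2 * p + 1"
  define m where "m = P * n - 1"
  have Pn: "P * n > 0" using assms by (simp add: P_def)
  have m1: "real m = (2 * real p + 1) * real n - 1"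
    unfolding m_def using Pn by (subst of_nat_diff) (auto simp: P_def algebra_simps)
  have e: "P * Suc n - 1 = Suc (m + 2 * p)" using Pn by (simp add: m_def P_def)
  have bci: "bci p i = real (N (P * i - 1))" for i
    by (simp add: BCI_count_eq N_def P_def)
  \<comment> \<open>By divisibility only the sizes \<open>P * i - 1\<close> contribute to the
    convolution.\<close>
  have conv: "(\<Sum>a\<le>m + 2 * p. N a * N (m + 2 * p - a)) = (\<Sum>i=1..n. N (P * i - 1) * N (P * (Suc n - i) - 1))"
  proof -
    have "(\<Sum>a\<le>m + 2 * p. N a * N (m + 2 * p - a)) =
        (\<Sum>a\<in>(\<lambda>i. P * i - 1) ` {1..n}. N a * N (m + 2 * p - a))"
    proof (rule sum.mono_neutral_right)
      show "(\<lambda>i. P * i - 1) ` {1..n} \<subseteq> {..m + 2 * p}"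
      proof
        fix a assume "a \<in> (\<lambda>i. P * i - 1) ` {1..n}"
        then obtain i where "i \<le> n" "a = P * i - 1" by auto
        then have "a \<le> m" unfolding m_def using mult_le_mono2[of i n P] by linarith
        then show "a \<in> {..m + 2 * p}" by simp
      qed
      show "\<forall>a\<in>{..m + 2 * p} - (\<lambda>i. P * i - 1) ` {1..n}. N a * N (m + 2 * p - a) = 0"
      proof
        fix a assume a: "a \<in> {..m + 2 * p} - (\<lambda>i. P * i - 1) ` {1..n}"
        have "N a = 0"
        proof (rule ccontr)
          assume "N a \<noteq> 0"
          then have "P dvd Suc a" unfolding N_def P_def by (rule dvd_of_hole_terms_0[OF assms(1)])
          then obtain i where i: "Suc a = P * i" by (elim dvdE)
          \<comment> \<open>This bounds \<open>i\<close> by \<open>n\<close>; \<open>i = 0\<close>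
            is impossible since \<open>Suc a\<close> is positive.\<close>
          have "Suc a < P * Suc n" using a e by auto
          then have "i < Suc n" unfolding i by (simp only: mult_less_cancel1)
          then have "i \<le> n" by simp
          moreover have "i \<ge> 1" using i by (cases i) auto
          moreover have "a = P * i - 1" using i by simp
          ultimately show False using a by auto
        qed
        then show "N a * N (m + 2 * p - a) = 0" by simp
      qed
    qed simp
    also have "\<dots> = (\<Sum>i=1..n. N (P * i - 1) * N (m + 2 * p - (P * i - 1)))"
    proof (rule sum.reindex[unfolded o_def])
      show "inj_on (\<lambda>i. P * i - 1) {1..n}"
      proof (rule inj_onI)
        fix i j assume "i \<in> {1..n}" "j \<in> {1..n}" "P * i - 1 = P * j - 1"
        \<comment> \<open>Positivity is essential: truncated subtraction of 1 identifies 0 and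
          1.\<close>
        moreover have "P * i > 0" "P * j > 0" using calculation by (auto simp: P_def)
        ultimately have "P * i = P * j" by linarith
        moreover have "P \<noteq> 0" by (simp add: P_def)
        ultimately show "i = j" by simp
      qed
    qed
    also have "\<dots> = (\<Sum>i=1..n. N (P * i - 1) * N (P * (Suc n - i) - 1))"
    proof (rule sum.cong[OF refl])
      fix i assume i: "i \<in> {1..n}"
      then have "P * i > 0" "P * i \<le> P * n" using mult_le_mono2[of i n P] by (auto simp: P_def)
      moreover have "P * (Suc n - i) = P * n + P - P * i"
        using i by (simp add: diff_mult_distrib2)
      ultimately have "m + 2 * p - (P * i - 1) = P * (Suc n - i) - 1"
        by (simp add: m_def) (simp add: P_def)
      then show "N (P * i - 1) * N (m + 2 * p - (P * i - 1)) = N (P * i - 1) * N (P * (Suc n - i) - 1)"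
        by simp
    qed
    finally show ?thesis .
  qed
  have "real (N (P * Suc n - 1)) = (\<Sum>i=1..n. real (N (P * i - 1)) * real (N (P * (Suc n - i) - 1)))
      + real (card (hole_terms p p (m + 2 * p)))"
    unfolding e using card_hole_terms_0_Suc[of p "m + 2 * p"] conv by (simp add: N_def)
  then show ?thesis
    unfolding bci card_hole_terms_add[OF assms(1)] lam_factor_def m1 by (simp add: N_def m_def)
qed

section \<open>Quadratic recurrences dominated by their linear part\<close>

lemma sum_inverse_squares_le_2: "(\<Sum>j=1..<n. 1 / (real j)\<^sup>2) \<le> 2"
proof -
  \<comment> \<open>The stronger bound makes the induction telescope.\<close>
  have *: "(\<Sum>j=1..<Suc n. 1 / (real j)\<^sup>2) \<le> 2 - 1 / real n" if "n \<ge> 1" for n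
    using that
  proof (induction n rule: dec_induct)
    case (step n)
    have "1 / (real (Suc n))\<^sup>2 \<le> 1 / real n - 1 / real (Suc n)"
      using step.hyps by (simp add: divide_simps power2_eq_square)
    with step.IH show ?case by simp
  qed simp
  show ?thesis
  proof (cases "n \<ge> 2")
    case True
    then have "(\<Sum>j=1..<Suc (n - 1). 1 / (real j)\<^sup>2) \<le> 2 - 1 / real (n - 1)"
      by (intro *) auto
    also have "\<dots> \<le> 2" by simp
    finally show ?thesis using True by simp
  qed (auto simp: not_le less_2_cases_iff)
qed

text \<open>A bootstrap for \<open>d n = b n / P n\<close>: while earlier values are at most 2, step
  \<open>n\<close> adds at most 4 times \<open>S n\<close>, hence at most
  \<open>12 * \<epsilon> / n^2\<close>. These increments total at most
  \<open>24 * \<epsilon> \<le> 1\<close>, which preserves the bound 2. Monotonicity then gives the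
  limit.\<close>

lemma quadratic_recurrence_limit:
  fixes b c :: "nat \<Rightarrow> real"
  assumes b1: "b 1 > 0" and c1: "24 * b 1 \<le> c 1"
    and mono: "\<And>n. n \<ge> 1 \<Longrightarrow> c n \<le> c (Suc n)"
    and growth: "\<And>n. n \<ge> 1 \<Longrightarrow> c 1 * (real n)\<^sup>2 \<le> c n"
    and rec: "\<And>n. n \<ge> 1 \<Longrightarrow> b (Suc n) = c n * b n + (\<Sum>i=1..n. b i * b (Suc n - i))"
  shows "\<exists>L. 1 \<le> L \<and> L \<le> 1 + 24 * (b 1 / c 1) \<and> (\<lambda>n. b n / (b 1 * (\<Prod>j=1..<n. c j))) \<longlonglongrightarrow> L"
proof -
  define P where "P n = b 1 * (\<Prod>j=1..<n. c j)" for n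
  define d where "d n = b n / P n" for n
  define \<epsilon> where "\<epsilon> = b 1 / c 1"
  have c1_pos: "c 1 > 0" using b1 c1 by linarith
  have c_pos: "c n > 0" if "n \<ge> 1" for n
  proof -
    have "0 < c 1 * (real n)\<^sup>2" using c1_pos that by simp
    with growth[OF that] show ?thesis by linarith
  qed
  have c_mono: "c i \<le> c j" if "1 \<le> i" "i \<le> j" for i j
    using that(2)
  proof (induction j rule: dec_induct)
    case (step n)
    with mono[of n] that(1) show ?case by linarith
  qed simp
  have P_pos: "P n > 0" for n
    unfolding P_def using b1 c_pos by (intro mult_pos_pos prod_pos) auto
  have P_1: "P 1 = b 1" by (simp add: P_def)
  have P_Suc: "P (Suc n) = c n * P n" if "n \<ge> 1" for n
    using that by (simp add: P_def)
  have b_eq: "b n = P n * d n" for n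
    using P_pos[of n] by (simp add: d_def)
  have \<epsilon>: "0 < \<epsilon>" "24 * \<epsilon> \<le> 1"
    using b1 c1 c1_pos by (auto simp: \<epsilon>_def field_simps)
  \<comment> \<open>Log-convexity of \<open>P\<close>, from the monotonicity of \<open>c\<close>: a
    product with fixed index sum is largest at the extremes. Indices start at 2 because the end
    terms of the convolution are treated separately.\<close>
  have P_shift: "P (2 + k) * P (2 + l) \<le> P 2 * P (2 + k + l)" for k l
  proof (induction k)
    case (Suc k)
    have "P (2 + Suc k) * P (2 + l) = c (2 + k) * (P (2 + k) * P (2 + l))"
      using P_Suc[of "2 + k"] by simp
    also have "\<dots> \<le> c (2 + k) * (P 2 * P (2 + k + l))"
      using c_pos[of "2 + k"] by (intro mult_left_mono Suc.IH) auto
    also have "\<dots> \<le> c (2 + k + l) * (P 2 * P (2 + k + l))"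
      using P_pos by (intro mult_right_mono c_mono) (auto intro: less_imp_le)
    also have "\<dots> = P 2 * P (2 + Suc k + l)"
      using P_Suc[of "2 + k + l"] by simp
    finally show ?case .
  qed simp
  \<comment> \<open>The increment of \<open>d\<close> with every \<open>d i\<close> replaced by
    1.\<close>
  define S where "S n = (\<Sum>i=1..n. P i * P (Suc n - i)) / P (Suc n)" for n
  have S_le: "S n \<le> 3 * \<epsilon> * (1 / (real n)\<^sup>2)" if n: "n \<ge> 1" for n
  proof -
    \<comment> \<open>For \<open>n \<ge> 2\<close> the two end terms give
      \<open>2 * P 1 * P n\<close>. The \<open>n - 2\<close> inner terms are each at most
      \<open>P 2 * P (n - 1)\<close>, and growth of \<open>c\<close> bounds their sum by one more
      \<open>P 1 * P n\<close>.\<close>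
    have "(\<Sum>i=1..n. P i * P (Suc n - i)) \<le> 3 * P 1 * P n"
    proof (cases "n = 1")
      case True
      then show ?thesis using P_pos[of 1] by simp
    next
      case False
      with n have n2: "n \<ge> 2" by simp
      have eq: "{1..n} = insert 1 (insert n {2..n - 1})" using n2 by auto
      have "(\<Sum>i=1..n. P i * P (Suc n - i)) = 2 * (P 1 * P n) + (\<Sum>i=2..n - 1. P i * P (Suc n - i))"
        unfolding eq using n2 by simp
      also have "(\<Sum>i=2..n - 1. P i * P (Suc n - i)) \<le> (\<Sum>i=2..n - 1. P 2 * P (n - 1))"
      proof (rule sum_mono)
        fix i assume i: "i \<in> {2..n - 1}"
        then have "2 + (i - 2) = i" "2 + (n - 1 - i) = Suc n - i" "2 + (i - 2) + (n - 1 - i) = n - 1"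
          by auto
        with P_shift[of "i - 2" "n - 1 - i"] show "P i * P (Suc n - i) \<le> P 2 * P (n - 1)"
          by (simp only:)
      qed
      also have "\<dots> = real (n - 2) * (c 1 * P 1 * P (n - 1))"
        using P_Suc[of 1] by (simp add: numeral_2_eq_2)
      also have "\<dots> = P 1 * P (n - 1) * (c 1 * real (n - 2))" by simp
      also have "\<dots> \<le> P 1 * P (n - 1) * c (n - 1)"
      proof (rule mult_left_mono)
        have "real (n - 2) \<le> real (n - 1)" by simp
        also have "\<dots> \<le> (real (n - 1))\<^sup>2"
          using n2 by (simp add: power2_eq_square)
        finally have "c 1 * real (n - 2) \<le> c 1 * (real (n - 1))\<^sup>2"
          using c1_pos by simp
        also have "\<dots> \<le> c (n - 1)" using n2 by (intro growth) simp
        finally show "c 1 * real (n - 2) \<le> c (n - 1)" .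
        show "0 \<le> P 1 * P (n - 1)" using P_pos by (simp add: less_imp_le)
      qed
      also have "\<dots> = P 1 * P n"
        using P_Suc[of "n - 1"] n2 by simp
      finally show ?thesis by (simp add: mult_ac)
    qed
    then have "S n \<le> 3 * P 1 * P n / P (Suc n)"
      unfolding S_def using P_pos[of "Suc n"] by (intro divide_right_mono) auto
    also have "\<dots> = 3 * b 1 / c n"
      using P_Suc[OF n] P_pos[of n] P_1 by simp
    also have "\<dots> \<le> 3 * b 1 / (c 1 * (real n)\<^sup>2)"
      using growth[OF n] b1 c1_pos n by (intro divide_left_mono) (auto simp: c_pos)
    finally show ?thesis by (simp add: \<epsilon>_def)
  qed
  have d_1: "d 1 = 1" using b1 P_1 by (simp add: d_def)
  have d_Suc: "d (Suc n) = d n + (\<Sum>i=1..n. P i * P (Suc n - i) * (d i * d (Suc n - i))) / P (Suc n)"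
    if "n \<ge> 1" for n
  proof -
    have "b (Suc n) = c n * (P n * d n) + (\<Sum>i=1..n. P i * P (Suc n - i) * (d i * d (Suc n - i)))"
      unfolding rec[OF that] by (simp add: b_eq mult_ac)
    then have "d (Suc n) = (c n * (P n * d n) + (\<Sum>i=1..n. P i * P (Suc n - i) * (d i * d (Suc n - i)))) / P (Suc n)"
      by (simp only: d_def[of "Suc n"])
    then show ?thesis
      using P_Suc[OF that] P_pos[of n] c_pos[OF that] by (simp add: add_divide_distrib)
  qed
  \<comment> \<open>Keeping the partial sum in the bound lets each increment be absorbed by its next
    term.\<close>
  have d_bounds: "0 \<le> d n \<and> d n \<le> 1 + 12 * \<epsilon> * (\<Sum>j=1..<n. 1 / (real j)\<^sup>2)" if "n \<ge> 1" for n
    using that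
  proof (induction n rule: less_induct)
    case (less n)
    show ?case
    proof (cases "n = 1")
      case False
      with less.prems obtain m where m: "n = Suc m" "m \<ge> 1" by (cases n) auto
      have d: "0 \<le> d i \<and> d i \<le> 2" if "1 \<le> i" "i \<le> m" for i
      proof -
        have "12 * \<epsilon> * (\<Sum>j=1..<i. 1 / (real j)\<^sup>2) \<le> 12 * \<epsilon> * 2"
          using \<epsilon> by (intro mult_left_mono sum_inverse_squares_le_2) auto
        moreover have "0 \<le> d i \<and> d i \<le> 1 + 12 * \<epsilon> * (\<Sum>j=1..<i. 1 / (real j)\<^sup>2)"
          using less.IH[of i] that m by simp
        ultimately show ?thesis using \<epsilon>(2) by linarith
      qed
      let ?T = "(\<Sum>i=1..m. P i * P (Suc m - i) * (d i * d (Suc m - i)))"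
      have T: "0 \<le> ?T" using d P_pos by (intro sum_nonneg mult_nonneg_nonneg) (auto intro: less_imp_le)
      have "?T \<le> (\<Sum>i=1..m. P i * P (Suc m - i) * (2 * 2))"
      proof (intro sum_mono mult_left_mono)
        fix i assume "i \<in> {1..m}"
        then show "d i * d (Suc m - i) \<le> 2 * 2" using d by (intro mult_mono) auto
      qed (use P_pos in \<open>auto intro: less_imp_le\<close>)
      also have "\<dots> = (\<Sum>i=1..m. P i * P (Suc m - i)) * 4" by (simp add: sum_distrib_right)
      finally have "?T / P (Suc m) \<le> 4 * S m"
        unfolding S_def using P_pos[of "Suc m"] by (simp add: field_simps)
      also have "\<dots> \<le> 12 * \<epsilon> * (1 / (real m)\<^sup>2)" using S_le[OF m(2)] by simp
      finally have "?T / P (Suc m) \<le> 12 * \<epsilon> * (1 / (real m)\<^sup>2)" .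
      moreover have "0 \<le> ?T / P (Suc m)" using T P_pos[of "Suc m"] by simp
      moreover have "0 \<le> d m" "d m \<le> 1 + 12 * \<epsilon> * (\<Sum>j=1..<m. 1 / (real j)\<^sup>2)"
        using less.IH[of m] m by auto
      ultimately show ?thesis
        unfolding m(1) d_Suc[OF m(2)] using m(2) by (simp add: algebra_simps)
    qed (use d_1 in simp)
  qed
  have d_le: "d n \<le> 1 + 24 * \<epsilon>" if "n \<ge> 1" for n
  proof -
    have "12 * \<epsilon> * (\<Sum>j=1..<n. 1 / (real j)\<^sup>2) \<le> 12 * \<epsilon> * 2"
      using \<epsilon> by (intro mult_left_mono sum_inverse_squares_le_2) auto
    with d_bounds[OF that] show ?thesis by linarith
  qed
  \<comment> \<open>Shifted by one, as nothing is assumed about \<open>b 0\<close>.\<close>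
  have "incseq (\<lambda>n. d (Suc n))"
  proof (rule incseq_SucI)
    fix n
    have "0 \<le> (\<Sum>i=1..Suc n. P i * P (Suc (Suc n) - i) * (d i * d (Suc (Suc n) - i))) / P (Suc (Suc n))"
      using d_bounds P_pos by (intro divide_nonneg_nonneg sum_nonneg mult_nonneg_nonneg) (auto intro: less_imp_le)
    then show "d (Suc n) \<le> d (Suc (Suc n))" using d_Suc[of "Suc n"] by linarith
  qed
  then obtain L where L: "(\<lambda>n. d (Suc n)) \<longlonglongrightarrow> L" "\<And>n. d (Suc n) \<le> L"
    using incseq_convergent[of "\<lambda>n. d (Suc n)" "1 + 24 * \<epsilon>"] d_le by auto
  have "1 \<le> L" using L(2)[of 0] d_1 by simp
  moreover have "L \<le> 1 + 24 * \<epsilon>"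
    using d_le by (intro LIMSEQ_le_const2[OF L(1)]) auto
  moreover have "d \<longlonglongrightarrow> L" using L(1) by (simp add: filterlim_sequentially_Suc)
  ultimately show ?thesis unfolding d_def[abs_def] P_def \<epsilon>_def by blast
qed

section \<open>Asymptotics of the linear product via the Gamma function\<close>

lemma pochhammer_asymp_equiv:
  fixes \<alpha> :: real
  assumes "\<alpha> \<notin> \<int>\<^sub>\<le>\<^sub>0"
  shows "(\<lambda>n. pochhammer (1 + \<alpha>) (n - 1)) \<sim>[at_top] (\<lambda>n. fact (n - 1) * real n powr \<alpha> / Gamma (1 + \<alpha>))"
proof (rule asymp_equivI')
  have \<alpha>: "\<alpha> \<noteq> 0" and G: "Gamma \<alpha> \<noteq> 0"
    using assms by (auto simp: Gamma_eq_zero_iff)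
  have "(\<lambda>n. Gamma \<alpha> / Gamma_series' \<alpha> n) \<longlonglongrightarrow> Gamma \<alpha> / Gamma \<alpha>"
    by (intro tendsto_intros Gamma_series'_LIMSEQ G)
  \<comment> \<open>Both \<open>pochhammer \<alpha> n\<close> and
    \<open>Gamma (1 + \<alpha>)\<close> split off a factor \<open>\<alpha>\<close>, which cancels;
    what remains is Euler's limit formula.\<close>
  moreover have "eventually (\<lambda>n. Gamma \<alpha> / Gamma_series' \<alpha> n =
      pochhammer (1 + \<alpha>) (n - 1) / (fact (n - 1) * real n powr \<alpha> / Gamma (1 + \<alpha>))) sequentially"
    using eventually_gt_at_top[of 0]
  proof eventually_elim
    case (elim n)
    then obtain m where m: "n = Suc m" by (cases n) auto
    have "Gamma (1 + \<alpha>) = \<alpha> * Gamma \<alpha>" using Gamma_plus1[OF assms] by (simp add: add.commute)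
    moreover have "pochhammer \<alpha> (Suc m) = \<alpha> * pochhammer (1 + \<alpha>) m"
      by (simp add: pochhammer_rec add.commute)
    ultimately show ?case
      unfolding m Gamma_series'_def by (simp add: powr_def)
  qed
  ultimately show "(\<lambda>n. pochhammer (1 + \<alpha>) (n - 1) / (fact (n - 1) * real n powr \<alpha> / Gamma (1 + \<alpha>))) \<longlonglongrightarrow> 1"
    using G by (simp add: Lim_transform_eventually)
qed

lemma asymp_equiv_prod_finite:
  fixes f g :: "'i \<Rightarrow> 'a \<Rightarrow> 'b :: real_normed_field"
  assumes "finite A" "\<And>i. i \<in> A \<Longrightarrow> f i \<sim>[F] g i"
  shows "(\<lambda>x. \<Prod>i\<in>A. f i x) \<sim>[F] (\<lambda>x. \<Prod>i\<in>A. g i x)"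
  using assms by (induction A rule: finite_induct) (auto intro!: asymp_equiv_mult)

text \<open>The factors of \<open>lam_factor p n\<close> divided by \<open>2 * p + 1\<close> are
  \<open>n + shift p i\<close>, so their products over \<open>n\<close> are Pochhammer
  symbols.\<close>

abbreviation shift :: "nat \<Rightarrow> nat \<Rightarrow> real" where
  "shift p i \<equiv> (2 * real i - 1) / (2 * real p + 1)"

lemma lam_factor_eq: "lam_factor p n = beta_const p * (\<Prod>i<p. real n + shift p i)"
proof -
  have nz: "2 * real p + 1 \<noteq> 0" by linarith
  have "(\<Prod>i<p. (2 * real p + 1) * real n - 1 + 2 * real i) =
      (\<Prod>i<p. (2 * real p + 1) * (real n + shift p i))"
    using nz by (intro prod.cong refl) (simp add: field_simps)
  also have "\<dots> = (2 * real p + 1) ^ p * (\<Prod>i<p. real n + shift p i)"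
    by (simp add: prod.distrib)
  finally have "lam_factor p n = (2 ^ p * (2 * real p + 1) ^ p) / fact p * (\<Prod>i<p. real n + shift p i)"
    by (simp add: lam_factor_def)
  also have "2 ^ p * (2 * real p + 1) ^ p = (4 * real p + 2) ^ p"
    by (simp flip: power_mult_distrib add: algebra_simps)
  finally show ?thesis by (simp add: beta_const_def)
qed

text \<open>If the shift were \<open>-k\<close>, then \<open>2 * i - 1 = -k * (2 * p + 1)\<close>:
  parity excludes \<open>k = 0\<close>, and for \<open>k \<ge> 1\<close> the right side is below
  -1.\<close>

lemma not_nonpos_Int_shift:
  assumes "p > 0"
  shows "shift p i \<notin> \<int>\<^sub>\<le>\<^sub>0"
proof
  assume "shift p i \<in> \<int>\<^sub>\<le>\<^sub>0"
  then obtain k where k: "shift p i = - real k" by (auto elim!: nonpos_Ints_cases')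
  have "2 * real p + 1 > 0" by linarith
  with k have *: "2 * real i - 1 = - real k * (2 * real p + 1)" by (simp add: field_simps)
  show False
  proof (cases "k = 0")
    case True
    with * have "real (2 * i) = real 1" by simp
    then show False unfolding of_nat_eq_iff by presburger
  next
    case False
    define X where "X = real k * (2 * real p + 1)"
    have "1 * (2 * real p + 1) \<le> X" unfolding X_def using False by (intro mult_right_mono) auto
    moreover have "2 * real i - 1 = - X" using * by (simp add: X_def)
    ultimately show False using assms by simp
  qed
qed

lemma sum_shift: "(\<Sum>i<p. shift p i) = gamma_const p"
proof -
  have "(\<Sum>i<p. 2 * real i - 1) = real p * (real p - 2)" for p
    by (induction p) (auto simp: algebra_simps)
  then show ?thesis by (simp add: gamma_const_def flip: sum_divide_distrib)
qed

text \<open>After exchanging the products, each \<open>i\<close> contributes one Pochhammer symbol;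
  the exponents \<open>shift p i\<close> of \<open>n\<close> add up to
  \<open>gamma_const p\<close>.\<close>

lemma prod_lam_factor_asymp_equiv:
  assumes "p > 0"
  shows "(\<lambda>n. \<Prod>j=1..<n. lam_factor p j) \<sim>[at_top]
     (\<lambda>n. (\<Prod>i<p. 1 / Gamma (1 + shift p i)) * beta_const p ^ (n - 1) * real n powr gamma_const p * fact (n - 1) ^ p)"
proof -
  have *: "(\<Prod>j=1..<n. real j + a) = pochhammer (1 + a) (n - 1)" for n a
  proof -
    have "(\<Prod>j=1..<n. real j + a) = (\<Prod>j=0..<n - 1. 1 + a + real j)"
      by (rule prod.reindex_bij_witness[of _ Suc "\<lambda>j. j - 1"]) auto
    then show ?thesis by (simp add: pochhammer_prod)
  qed
  have "(\<lambda>n. beta_const p ^ (n - 1) * (\<Prod>i<p. pochhammer (1 + shift p i) (n - 1))) \<sim>[at_top]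
      (\<lambda>n. beta_const p ^ (n - 1) * (\<Prod>i<p. fact (n - 1) * real n powr shift p i / Gamma (1 + shift p i)))"
    by (intro asymp_equiv_mult asymp_equiv_refl asymp_equiv_prod_finite pochhammer_asymp_equiv
        not_nonpos_Int_shift assms) auto
  also have "(\<lambda>n. beta_const p ^ (n - 1) * (\<Prod>i<p. pochhammer (1 + shift p i) (n - 1))) =
      (\<lambda>n. \<Prod>j=1..<n. lam_factor p j)"
  proof
    fix n
    have "(\<Prod>j=1..<n. lam_factor p j) = beta_const p ^ (n - 1) * (\<Prod>j=1..<n. \<Prod>i<p. real j + shift p i)"
      by (simp add: lam_factor_eq prod.distrib)
    also have "(\<Prod>j=1..<n. \<Prod>i<p. real j + shift p i) = (\<Prod>i<p. pochhammer (1 + shift p i) (n - 1))"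
      by (subst prod.swap) (simp only: *)
    finally show "beta_const p ^ (n - 1) * (\<Prod>i<p. pochhammer (1 + shift p i) (n - 1)) =
        (\<Prod>j=1..<n. lam_factor p j)" by simp
  qed
  also have "(\<lambda>n. beta_const p ^ (n - 1) * (\<Prod>i<p. fact (n - 1) * real n powr shift p i / Gamma (1 + shift p i)))
      \<sim>[at_top] (\<lambda>n. (\<Prod>i<p. 1 / Gamma (1 + shift p i)) * beta_const p ^ (n - 1) * real n powr gamma_const p * fact (n - 1) ^ p)"
    by (intro asymp_equiv_refl_ev eventually_mono[OF eventually_gt_at_top[of 0]])
      (simp add: sum_shift[symmetric] powr_sum prod.distrib prod_dividef)
  finally show ?thesis .
qed

lemma B_const_eq:
  assumes "p > 0"
  shows "B_const p = bci p 1 * (\<Prod>i<p. 1 / Gamma (1 + shift p i))"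
proof -
  have "(\<Prod>k=1..p. 1 / Gamma (1 + (2 * (real p - real k) - 1) / (2 * real p + 1))) =
      (\<Prod>i<p. 1 / Gamma (1 + shift p i))"
    by (rule prod.reindex_bij_witness[of _ "\<lambda>i. p - i" "\<lambda>k. p - k"]) (auto simp: of_nat_diff)
  then show ?thesis unfolding B_const_def bci_1[OF assms] by simp
qed

section \<open>Growth and initial size of the linear coefficient\<close>

lemma lam_factor_mono: "p > 0 \<Longrightarrow> n \<ge> 1 \<Longrightarrow> lam_factor p n \<le> lam_factor p (Suc n)"
  unfolding lam_factor_def
proof (intro mult_left_mono prod_mono conjI)
  fix i assume "n \<ge> 1"
  have "(2 * real p + 1) * 1 \<le> (2 * real p + 1) * real n"
    using \<open>n \<ge> 1\<close> by (intro mult_left_mono) auto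
  then have "(2 * real p + 1) * 1 - 1 + 2 * real i \<le> (2 * real p + 1) * real n - 1 + 2 * real i"
    by (intro add_right_mono diff_right_mono)
  then show "0 \<le> (2 * real p + 1) * real n - 1 + 2 * real i"
    by (rule order_trans[rotated]) simp
  have "(2 * real p + 1) * real n \<le> (2 * real p + 1) * real (Suc n)"
    by (intro mult_left_mono) auto
  then show "(2 * real p + 1) * real n - 1 + 2 * real i \<le> (2 * real p + 1) * real (Suc n) - 1 + 2 * real i"
    by linarith
qed simp

lemma lam_factor_growth:
  assumes "p \<ge> 2" "n \<ge> 1"
  shows "lam_factor p 1 * (real n)\<^sup>2 \<le> lam_factor p n"
proof -
  define f where "f n i = (2 * real p + 1) * real n - 1 + 2 * real i" for n i
  obtain q where q: "p = Suc (Suc q)" using assms(1) by (metis add_2_eq_Suc le_Suc_ex)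
  have split: "(\<Prod>i<p. f m i) = f m 0 * f m 1 * (\<Prod>i<q. f m (Suc (Suc i)))" for m
    unfolding q by (simp only: prod.lessThan_Suc_shift) simp
  have pos: "f 1 i \<ge> 0" for i by (simp add: f_def)
  have mono: "f 1 i \<le> f n i" for i
  proof -
    have "(2 * real p + 1) * 1 \<le> (2 * real p + 1) * real n"
      using assms(2) by (intro mult_left_mono) auto
    then show ?thesis unfolding f_def by linarith
  qed
  \<comment> \<open>With \<open>P = 2 * p + 1\<close> this reads
    \<open>(P^2 - 1) * n^2 \<le> P^2 * n^2 - 1\<close>. Two factors thus supply the quadratic
    growth, and monotonicity suffices for the others.\<close>
  have "f 1 0 * f 1 1 * (real n)\<^sup>2 \<le> f n 0 * f n 1"
  proof -
    have "1 \<le> (real n)\<^sup>2" using assms(2) by simp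
    then show ?thesis by (simp add: f_def algebra_simps power2_eq_square)
  qed
  moreover have "(\<Prod>i<q. f 1 (Suc (Suc i))) \<le> (\<Prod>i<q. f n (Suc (Suc i)))"
    using pos mono by (intro prod_mono) auto
  ultimately have "f 1 0 * f 1 1 * (real n)\<^sup>2 * (\<Prod>i<q. f 1 (Suc (Suc i))) \<le> f n 0 * f n 1 * (\<Prod>i<q. f n (Suc (Suc i)))"
    using pos order_trans[OF pos mono] by (intro mult_mono[of "_ * _ * _"]) (auto intro!: prod_nonneg mult_nonneg_nonneg)
  then have "(\<Prod>i<p. f 1 i) * (real n)\<^sup>2 \<le> (\<Prod>i<p. f n i)"
    unfolding split by (simp only: mult_ac)
  then have "2 ^ p / fact p * ((\<Prod>i<p. f 1 i) * (real n)\<^sup>2) \<le> 2 ^ p / fact p * (\<Prod>i<p. f n i)"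
    by (rule mult_left_mono) simp
  then show ?thesis unfolding lam_factor_def f_def by (simp only: mult.assoc)
qed

text \<open>Here \<open>lam_factor p 1\<close> is \<open>4 ^ p\<close> times the binomial (2p-1
  choose p), which by Pascal's rule is at least (2p-2 choose p-1), that is,
  \<open>p * bci p 1\<close>.\<close>

lemma bci_1_le:
  assumes "p > 0"
  shows "real p * 4 ^ p * bci p 1 \<le> lam_factor p 1"
proof -
  obtain q where q: "p = Suc q" using assms by (cases p) auto
  have "lam_factor p 1 = 2 ^ p / fact p * (\<Prod>i<p. 2 * (real p + real i))"
    unfolding lam_factor_def by (simp add: algebra_simps)
  also have "\<dots> = 2 ^ p * 2 ^ p * (pochhammer (real p) p / fact p)"
    by (simp only: prod.distrib prod_constant card_lessThan pochhammer_prod atLeast0LessThan) simp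
  also have "pochhammer (real p) p / fact p = real (2 * p - 1) gchoose p"
    unfolding gbinomial_pochhammer' by (simp add: q add.commute)
  also have "\<dots> = real (Suc (2 * q) choose Suc q)"
    unfolding binomial_gbinomial by (simp add: q)
  finally have eq: "lam_factor p 1 = 4 ^ p * real (Suc (2 * q) choose Suc q)"
    by (simp flip: power_mult_distrib)
  have "real p * 4 ^ p * bci p 1 = 4 ^ p * real (2 * q choose q)"
    unfolding bci_1[OF assms] by (simp add: q del: of_nat_Suc)
  also have "\<dots> \<le> lam_factor p 1"
    unfolding eq by (intro mult_left_mono) (auto simp: binomial_Suc_Suc)
  finally show ?thesis .
qed

section \<open>The limit constant and the final asymptotics\<close>

lemma bci_limit:
  assumes "p \<ge> 2"
  shows "\<exists>L. 1 \<le> L \<and> L \<le> 1 + 24 / (real p * 4 ^ p) \<and>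
    (\<lambda>n. bci p n / (bci p 1 * (\<Prod>j=1..<n. lam_factor p j))) \<longlonglongrightarrow> L"
proof -
  have p: "p > 0" using assms by simp
  have pos: "bci p 1 > 0" unfolding bci_1[OF p] using assms by simp
  \<comment> \<open>The left side is 32, which exceeds the 24 required by the recurrence
    lemma.\<close>
  have "2 * 4 ^ 2 \<le> real p * 4 ^ p"
    using assms by (intro mult_mono power_increasing) auto
  then have "24 * bci p 1 \<le> real p * 4 ^ p * bci p 1"
    using pos by (intro mult_right_mono) auto
  also note bci_1_le[OF p]
  finally have "24 * bci p 1 \<le> lam_factor p 1" .
  then have "\<exists>L. 1 \<le> L \<and> L \<le> 1 + 24 * (bci p 1 / lam_factor p 1) \<and>
      (\<lambda>n. bci p n / (bci p 1 * (\<Prod>j=1..<n. lam_factor p j))) \<longlonglongrightarrow> L"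
    by (rule quadratic_recurrence_limit[of "bci p", OF pos])
      (rule lam_factor_mono[OF p] lam_factor_growth[OF assms] bci_Suc[OF p]; simp)+
  then obtain L where L: "1 \<le> L" "L \<le> 1 + 24 * (bci p 1 / lam_factor p 1)"
     "(\<lambda>n. bci p n / (bci p 1 * (\<Prod>j=1..<n. lam_factor p j))) \<longlonglongrightarrow> L"
    by blast
  have "bci p 1 / lam_factor p 1 \<le> bci p 1 / (real p * 4 ^ p * bci p 1)"
    using bci_1_le[OF p] pos p by (intro divide_left_mono mult_pos_pos) (auto intro: less_le_trans[rotated])
  also have "\<dots> = 1 / (real p * 4 ^ p)" using pos by simp
  finally have "L \<le> 1 + 24 / (real p * 4 ^ p)" using L(2) by simp
  with L show ?thesis by blast
qed

theorem theorem2: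
  shows "\<exists>a :: nat \<Rightarrow> real.
    (\<forall>p\<ge>2. a p > 0 \<and>
      (\<lambda>n. real (BCI_count p ((2 * p + 1) * n - 1))) \<sim>[at_top]
      (\<lambda>n. (a p * B_const p) * beta_const p ^ (n - 1) * real n powr gamma_const p * fact (n - 1) ^ p))
    \<and> (\<lambda>p. a p - 1) \<in> O(\<lambda>p. 1 / (real p * exp (real p)))"
proof -
  have "\<forall>p\<in>{2..}. \<exists>L. 1 \<le> L \<and> L \<le> 1 + 24 / (real p * 4 ^ p) \<and>
      (\<lambda>n. bci p n / (bci p 1 * (\<Prod>j=1..<n. lam_factor p j))) \<longlonglongrightarrow> L"
    by (intro ballI bci_limit) simp
  from bchoice[OF this] obtain a where "\<forall>p\<in>{2..}. 1 \<le> a p \<and> a p \<le> 1 + 24 / (real p * 4 ^ p) \<and>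
      (\<lambda>n. bci p n / (bci p 1 * (\<Prod>j=1..<n. lam_factor p j))) \<longlonglongrightarrow> a p" ..
  then have a: "1 \<le> a p" "a p \<le> 1 + 24 / (real p * 4 ^ p)"
    "(\<lambda>n. bci p n / (bci p 1 * (\<Prod>j=1..<n. lam_factor p j))) \<longlonglongrightarrow> a p" if "p \<ge> 2" for p
    using that by (simp_all only: atLeast_iff Ball_def)
  have "bci p \<sim>[at_top]
      (\<lambda>n. (a p * B_const p) * beta_const p ^ (n - 1) * real n powr gamma_const p * fact (n - 1) ^ p)"
    if p: "p \<ge> 2" for p
  proof -
    have "bci p \<sim>[at_top] (\<lambda>n. a p * (bci p 1 * (\<Prod>j=1..<n. lam_factor p j)))"
      using a[OF p] by (intro asymp_equivI'_const) auto
    also have "\<dots> \<sim>[at_top] (\<lambda>n. a p * (bci p 1 * ((\<Prod>i<p. 1 / Gamma (1 + shift p i)) *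
        beta_const p ^ (n - 1) * real n powr gamma_const p * fact (n - 1) ^ p)))"
      using p by (intro asymp_equiv_mult asymp_equiv_refl prod_lam_factor_asymp_equiv) simp
    finally show ?thesis using p by (simp only: B_const_eq mult.assoc)
  qed
  moreover have "(\<lambda>p. a p - 1) \<in> O(\<lambda>p. 1 / (real p * exp (real p)))"
  proof (rule bigoI)
    show "eventually (\<lambda>p. norm (a p - 1) \<le> 24 * norm (1 / (real p * exp (real p)))) at_top"
      using eventually_ge_at_top[of 2]
    proof eventually_elim
      case (elim p)
      \<comment> \<open>Since e is below 4, the bound of order \<open>1 / (p * 4 ^ p)\<close> is
        stronger than the one claimed.\<close>
      have "exp (real p) = exp 1 ^ p" by (simp flip: exp_of_nat_mult)
      also have "\<dots> \<le> 4 ^ p" using exp_le by (intro power_mono) auto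
      finally have "24 / (real p * 4 ^ p) \<le> 24 / (real p * exp (real p))"
        using elim by (intro divide_left_mono mult_left_mono) auto
      with a[OF elim] show ?case by simp
    qed
  qed
  ultimately show ?thesis using a by (intro exI[of _ a]) (auto intro: less_le_trans[OF zero_less_one])
qed

end
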